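(* Let $M$ be a complete pointed metric space and let $\lambda,\mu\in\mathcal{F}(M)$ be such that $\lambda\geq 0$ and $\mu$ has finite support. If $\lambda+\mu$ is an extreme point of the closed unit ball $B_{\mathcal{F}(M)}$, then $\lambda+\mu$ has finite support.
   Context: A pointed metric space $(M,d)$ has a distinguished base point $0\in M$. $\mathrm{Lip}_0(M)$ is the Banach space of all real-valued Lipschitz functions $f$ on $M$ with $f(0)=0$, normed by the Lipschitz constant $\|f\|_L$. For $x\in M$, $\delta(x)\in\mathrm{Lip}_0(M)^*$ is the evaluation functional $f\mapsto f(x)$. The Lipschitz-free space is $\mathcal{F}(M)=\overline{\mathrm{span}}\,\{\delta(x):x\in M\}\subset \mathrm{Lip}_0(M)^*$ (norm closure). For $K\subset M$, $\mathcal{F}_M(K)=\overline{\mathrm{span}}\,\{\delta(x):x\in K\}$, with $\mathrm{span}\,\varnothing=\{0\}$. The support $\mathrm{supp}(\mu)$ of $\mu\in\mathcal{F}(M)$ is the intersection of all closed subsets $K$ of $M$ such that $\mu\in\mathcal{F}_M(K)$. An element $\phi\in\mathcal{F}(M)$ is positive, written $\phi\ge 0$, if $\phi(f)\ge 0$ for every $f\in\mathrm{Lip}_0(M)$ with $f\ge 0$ pointwise. A point $x$ of a convex set $C$ is an extreme point of $C$ if it cannot be written as $x=\frac12(y+z)$ with $y,z\in C\setminus\{x\}$. *)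

theory Defs
  imports "HOL-Analysis.Analysis"
begin

class pointed_metric_space = metric_space +
  fixes base_point :: 'a

subsection \<open>The space of Lipschitz functions vanishing at the base point\<close>

typedef (overloaded) 'a lip0 =
  "{f :: 'a::pointed_metric_space \<Rightarrow> real. (\<exists>C. C-lipschitz_on UNIV f) \<and> f base_point = 0}"
  morphisms apply_lip0 Lip0
proof
  show "(\<lambda>_. 0) \<in> {f :: 'a \<Rightarrow> real. (\<exists>C. C-lipschitz_on UNIV f) \<and> f base_point = 0}"
    by (auto simp: lipschitz_on_def intro!: exI[of _ 0])
qed

setup_lifting type_definition_lip0

definition lip_const :: "('a::metric_space \<Rightarrow> real) \<Rightarrow> real"
  where "lip_const f = Inf {C. C-lipschitz_on UNIV f}"

lemma lip_const_le: "C-lipschitz_on UNIV f \<Longrightarrow> lip_const f \<le> C"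
  unfolding lip_const_def
  by (rule cInf_lower) (auto simp: bdd_below_def lipschitz_on_def)

lemma lip_const_lipschitz:
  assumes "C-lipschitz_on UNIV f"
  shows "(lip_const f)-lipschitz_on UNIV f"
proof (rule lipschitz_onI)
  show "0 \<le> lip_const f"
    unfolding lip_const_def
    by (rule cInf_greatest) (use assms in \<open>auto simp: lipschitz_on_def\<close>)
  fix x y :: 'a
  show "dist (f x) (f y) \<le> lip_const f * dist x y"
  proof (cases "x = y")
    case False
    then have pos: "0 < dist x y" by simp
    have "dist (f x) (f y) / dist x y \<le> lip_const f"
      unfolding lip_const_def
      by (rule cInf_greatest)
        (use assms pos in \<open>auto simp: lipschitz_on_def pos_divide_le_eq\<close>)
    with pos show ?thesis by (simp add: pos_divide_le_eq)
  qed simp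
qed

lemma lip_const_nonneg: "C-lipschitz_on UNIV f \<Longrightarrow> 0 \<le> lip_const f"
  using lip_const_lipschitz lipschitz_on_nonneg by blast

lemma lipschitz_on_scale_real:
  fixes f :: "'a::metric_space \<Rightarrow> real"
  assumes "C-lipschitz_on UNIV f"
  shows "(\<bar>r\<bar> * C)-lipschitz_on UNIV (\<lambda>x. r * f x)"
  using assms
  by (auto simp: lipschitz_on_def dist_real_def abs_mult mult.assoc mult_left_mono
      simp flip: right_diff_distrib)

lemma lip_const_scale_le:
  assumes "C-lipschitz_on UNIV f"
  shows "lip_const (\<lambda>x. r * f x) \<le> \<bar>r\<bar> * lip_const f"
  by (rule lip_const_le[OF lipschitz_on_scale_real[OF lip_const_lipschitz[OF assms]]])

instantiation lip0 :: (pointed_metric_space) real_vector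
begin

lift_definition zero_lip0 :: "'a lip0" is "\<lambda>_. 0"
  by (auto simp: lipschitz_on_def intro!: exI[of _ 0])

lift_definition plus_lip0 :: "'a lip0 \<Rightarrow> 'a lip0 \<Rightarrow> 'a lip0" is "\<lambda>f g x. f x + g x"
  by (auto intro: lipschitz_on_add)

lift_definition uminus_lip0 :: "'a lip0 \<Rightarrow> 'a lip0" is "\<lambda>f x. - f x"
  by (auto intro: lipschitz_on_minus)

lift_definition minus_lip0 :: "'a lip0 \<Rightarrow> 'a lip0 \<Rightarrow> 'a lip0" is "\<lambda>f g x. f x - g x"
  by (auto intro: lipschitz_on_diff)

lift_definition scaleR_lip0 :: "real \<Rightarrow> 'a lip0 \<Rightarrow> 'a lip0" is "\<lambda>r f x. r * f x"
  by (auto intro: lipschitz_on_scale_real)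

instance
  by standard (transfer; simp add: algebra_simps fun_eq_iff)+

end

instantiation lip0 :: (pointed_metric_space) real_normed_vector
begin

lift_definition norm_lip0 :: "'a lip0 \<Rightarrow> real" is lip_const .

definition sgn_lip0 :: "'a lip0 \<Rightarrow> 'a lip0"
  where "sgn_lip0 f = f /\<^sub>R norm f"

definition dist_lip0 :: "'a lip0 \<Rightarrow> 'a lip0 \<Rightarrow> real"
  where "dist_lip0 f g = norm (f - g)"

definition uniformity_lip0 :: "('a lip0 \<times> 'a lip0) filter"
  where "uniformity_lip0 = (INF e\<in>{0<..}. principal {(f, g). dist f g < e})"

definition open_lip0 :: "'a lip0 set \<Rightarrow> bool"
  where "open_lip0 U = (\<forall>f\<in>U. \<forall>\<^sub>F (f', g) in uniformity. f' = f \<longrightarrow> g \<in> U)"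

instance
proof
  fix f g :: "'a lip0" and r :: real
  show "dist f g = norm (f - g)" by (rule dist_lip0_def)
  show "sgn f = f /\<^sub>R norm f" by (rule sgn_lip0_def)
  show "uniformity = (INF e\<in>{0<..}. principal {(f :: 'a lip0, g). dist f g < e})"
    by (rule uniformity_lip0_def)
  show "open U = (\<forall>f\<in>U. \<forall>\<^sub>F (f', g) in uniformity. f' = f \<longrightarrow> g \<in> U)" for U :: "'a lip0 set"
    by (rule open_lip0_def)
  show "norm f = 0 \<longleftrightarrow> f = 0"
  proof transfer
    fix f :: "'a \<Rightarrow> real"
    assume f: "(\<exists>C. C-lipschitz_on UNIV f) \<and> f base_point = 0"
    then have L: "(lip_const f)-lipschitz_on UNIV f" by (auto intro: lip_const_lipschitz)
    show "lip_const f = 0 \<longleftrightarrow> f = (\<lambda>_. 0)"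
    proof
      assume "lip_const f = 0"
      then have "dist (f x) (f base_point) \<le> 0" for x
        using lipschitz_onD[OF L, of x base_point] by simp
      with f show "f = (\<lambda>_. 0)" by (auto simp: fun_eq_iff)
    next
      assume "f = (\<lambda>_. 0)"
      then have "0-lipschitz_on UNIV f" by (simp add: lipschitz_on_def)
      with lip_const_le lip_const_nonneg show "lip_const f = 0" by (metis order_antisym)
    qed
  qed
  show "norm (f + g) \<le> norm f + norm g"
    by transfer (blast intro: lip_const_le lipschitz_on_add lip_const_lipschitz)
  show "norm (r *\<^sub>R f) = \<bar>r\<bar> * norm f"
  proof transfer
    fix r :: real and f :: "'a \<Rightarrow> real"
    assume "(\<exists>C. C-lipschitz_on UNIV f) \<and> f base_point = 0"
    then obtain C where C: "C-lipschitz_on UNIV f" by auto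
    note rC = lipschitz_on_scale_real[OF C, of r]
    show "lip_const (\<lambda>x. r * f x) = \<bar>r\<bar> * lip_const f"
    proof (cases "r = 0")
      case True
      then show ?thesis
        using lip_const_scale_le[OF C, of r] lip_const_nonneg[OF rC] by simp
    next
      case False
      then have "lip_const f \<le> \<bar>inverse r\<bar> * lip_const (\<lambda>x. r * f x)"
        using lip_const_scale_le[OF rC, of "inverse r"] by (simp flip: mult.assoc)
      with False have "\<bar>r\<bar> * lip_const f \<le> lip_const (\<lambda>x. r * f x)"
        by (simp add: field_simps abs_inverse)
      with lip_const_scale_le[OF C, of r] show ?thesis by simp
    qed
  qed
qed

end

lemma abs_apply_lip0_le: "\<bar>apply_lip0 f x\<bar> \<le> norm f * dist x base_point"
proof transfer
  fix f :: "'a \<Rightarrow> real" and x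
  assume f: "(\<exists>C. C-lipschitz_on UNIV f) \<and> f base_point = 0"
  then have "(lip_const f)-lipschitz_on UNIV f" by (auto intro: lip_const_lipschitz)
  from lipschitz_onD[OF this, of x base_point] f
  show "\<bar>f x\<bar> \<le> lip_const f * dist x base_point" by (simp add: dist_real_def)
qed

subsection \<open>Lipschitz-free spaces\<close>

lift_definition lf_delta :: "'a::pointed_metric_space \<Rightarrow> 'a lip0 \<Rightarrow>\<^sub>L real"
  is "\<lambda>x f. apply_lip0 f x"
proof (rule bounded_linear_intro)
  fix x :: 'a and f g :: "'a lip0" and r :: real
  show "apply_lip0 (f + g) x = apply_lip0 f x + apply_lip0 g x" by transfer simp
  show "apply_lip0 (r *\<^sub>R f) x = r *\<^sub>R apply_lip0 f x" by transfer simp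
  show "norm (apply_lip0 f x) \<le> norm f * dist x base_point" by (simp add: abs_apply_lip0_le)
qed

definition lipfree_on :: "'a::pointed_metric_space set \<Rightarrow> ('a lip0 \<Rightarrow>\<^sub>L real) set"
  where "lipfree_on K = closure (span (lf_delta ` K))"

abbreviation lipfree :: "('a::pointed_metric_space lip0 \<Rightarrow>\<^sub>L real) set"
  where "lipfree \<equiv> lipfree_on UNIV"

definition lf_supp :: "('a::pointed_metric_space lip0 \<Rightarrow>\<^sub>L real) \<Rightarrow> 'a set"
  where "lf_supp \<mu> = \<Inter> {K. closed K \<and> \<mu> \<in> lipfree_on K}"

definition lf_positive :: "('a::pointed_metric_space lip0 \<Rightarrow>\<^sub>L real) \<Rightarrow> bool"
  where "lf_positive \<phi> \<longleftrightarrow> (\<forall>f. (\<forall>x. 0 \<le> apply_lip0 f x) \<longrightarrow> 0 \<le> blinfun_apply \<phi> f)"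

definition lipfree_ball :: "('a::pointed_metric_space lip0 \<Rightarrow>\<^sub>L real) set"
  where "lipfree_ball = {\<phi> \<in> lipfree. norm \<phi> \<le> 1}"

lemma convex_lipfree_ball: "convex lipfree_ball"
proof -
  have "lipfree_ball = lipfree \<inter> cball (0 :: 'a::pointed_metric_space lip0 \<Rightarrow>\<^sub>L real) 1"
    by (auto simp: lipfree_ball_def)
  then show ?thesis
    unfolding lipfree_on_def
    by (metis convex_Int convex_cball convex_closure subspace_imp_convex subspace_span)
qed

text \<open>
  On a convex set, the library notion \<^const>\<open>extreme_point_of\<close> is the usual midpoint condition.
\<close>

lemma extreme_point_of_midpoint:
  fixes C :: "'b::real_vector set"
  assumes "convex C"
  shows "x extreme_point_of C \<longleftrightarrow>
    x \<in> C \<and> \<not> (\<exists>y \<in> C - {x}. \<exists>z \<in> C - {x}. x = (1/2) *\<^sub>R (y + z))"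
proof
  assume x: "x extreme_point_of C"
  have False if yz: "y \<in> C - {x}" "z \<in> C - {x}" "x = (1/2) *\<^sub>R (y + z)" for y z
  proof -
    have "y \<noteq> z" using yz by (auto simp flip: scaleR_2)
    moreover have "x = (1 - 1/2) *\<^sub>R y + (1/2) *\<^sub>R z" using yz(3) by (simp add: scaleR_add_right)
    ultimately have "x \<in> open_segment y z"
      unfolding in_segment by (intro conjI exI[of _ "1/2"]) auto
    with x yz show False by (auto simp: extreme_point_of_def)
  qed
  with x show "x \<in> C \<and> \<not> (\<exists>y \<in> C - {x}. \<exists>z \<in> C - {x}. x = (1/2) *\<^sub>R (y + z))"
    by (auto simp: extreme_point_of_def)
next
  assume x: "x \<in> C \<and> \<not> (\<exists>y \<in> C - {x}. \<exists>z \<in> C - {x}. x = (1/2) *\<^sub>R (y + z))"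
  have False if ab: "a \<in> C" "b \<in> C" "x \<in> open_segment a b" for a b
  proof -
    from ab(3) obtain u where u: "a \<noteq> b" "0 < u" "u < 1" "x = (1 - u) *\<^sub>R a + u *\<^sub>R b"
      by (auto simp: in_segment)
    define t where "t = min u (1 - u)"
    have t: "0 < t" "t \<le> u" "t \<le> 1 - u" using u by (auto simp: t_def)
    define y where "y = x + t *\<^sub>R (b - a)"
    define z where "z = x - t *\<^sub>R (b - a)"
    have y_eq: "y = (1 - (u + t)) *\<^sub>R a + (u + t) *\<^sub>R b"
      and z_eq: "z = (1 - (u - t)) *\<^sub>R a + (u - t) *\<^sub>R b"
      by (simp_all add: y_def z_def u(4) algebra_simps)
    have "y \<in> C" unfolding y_eq by (rule convexD[OF assms ab(1,2)]) (use t u in auto)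
    moreover have "z \<in> C" unfolding z_eq by (rule convexD[OF assms ab(1,2)]) (use t u in auto)
    moreover have "y \<noteq> x" "z \<noteq> x" using t u(1) by (auto simp: y_def z_def)
    moreover have "x = (1/2) *\<^sub>R (y + z)" by (simp add: y_def z_def flip: scaleR_2)
    ultimately show False using x by blast
  qed
  with x show "x extreme_point_of C" by (auto simp: extreme_point_of_def)
qed

end

theory Submission
  imports Defs
begin

text \<open>
  Let \<open>F\<close> be the finite support of \<open>\<mu>\<close> and let \<open>h\<close> be a bump function with values in \<open>[0, 1]\<close>. If \<open>f\<close> and \<open>g\<close>
  are 1-Lipschitz and agree on \<open>F\<close>, then \<open>max f g\<close> is 1-Lipschitz, so positivity of \<open>\<lambda>\<close> yields
  \<open>\<lambda>(h f) + \<lambda>((1 - h) g) + \<mu>(g) \<le> (\<lambda> + \<mu>)(max f g) \<le> 1\<close>. Removing the finitely many constraints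
  \<open>f = g\<close> on \<open>F\<close> by Lagrange multipliers \<open>m\<close> gives \<open>\<parallel>\<alpha>\<parallel> + \<parallel>\<lambda> + \<mu> - \<alpha>\<parallel> \<le> 1\<close> for
  \<open>\<alpha> = \<lambda> \<circ> h - (\<Sum>x\<in>F. m x \<delta>(x))\<close>. By extremality \<open>\<lambda> + \<mu>\<close> is a multiple of \<open>\<alpha>\<close> as soon as \<open>\<alpha> \<noteq> 0\<close>, so
  away from \<open>F\<close> it lives on the support of \<open>h\<close>. Bumps around two different points outside \<open>F\<close> then
  exclude each other, whence the support of \<open>\<lambda> + \<mu>\<close> has at most one point outside \<open>F\<close>.
\<close>

section \<open>Multiplication by bounded Lipschitz functions\<close>

lemmas apply_lip0_simps =
  zero_lip0.rep_eq plus_lip0.rep_eq minus_lip0.rep_eq uminus_lip0.rep_eq scaleR_lip0.rep_eq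

lemma lip0_eqI: "(\<And>x. apply_lip0 f x = apply_lip0 g x) \<Longrightarrow> f = g"
  using apply_lip0_inject[of f g] by (simp add: fun_eq_iff)

lemma apply_lip0_base [simp]: "apply_lip0 f base_point = 0"
  using apply_lip0[of f] by simp

lemma apply_lf_delta [simp]: "blinfun_apply (lf_delta x) f = apply_lip0 f x"
  by (simp add: lf_delta.rep_eq)

lemma abs_apply_lip0_diff_le: "\<bar>apply_lip0 f x - apply_lip0 f y\<bar> \<le> norm f * dist x y"
proof -
  obtain C where "C-lipschitz_on UNIV (apply_lip0 f)"
    using apply_lip0[of f] by auto
  from lipschitz_onD[OF lip_const_lipschitz[OF this], of x y] show ?thesis
    by (simp add: norm_lip0.rep_eq dist_real_def)
qed

lemma norm_lip0_le:
  assumes "0 \<le> C" "\<And>x y. \<bar>apply_lip0 f x - apply_lip0 f y\<bar> \<le> C * dist x y"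
  shows "norm f \<le> C"
  unfolding norm_lip0.rep_eq
  by (rule lip_const_le) (use assms in \<open>auto simp: lipschitz_on_def dist_real_def\<close>)

lemma Lip0_bound:
  assumes "0 \<le> C" "\<And>x y. \<bar>f x - f y\<bar> \<le> C * dist x y" "f base_point = 0"
  shows apply_Lip0: "apply_lip0 (Lip0 f) = f"
    and norm_Lip0_le: "norm (Lip0 f) \<le> C"
proof -
  have "C-lipschitz_on UNIV f"
    using assms by (auto simp: lipschitz_on_def dist_real_def)
  with assms(3) show *: "apply_lip0 (Lip0 f) = f"
    by (intro Lip0_inverse) auto
  show "norm (Lip0 f) \<le> C"
    by (rule norm_lip0_le) (use assms in \<open>simp_all add: *\<close>)
qed

text \<open>
  The weight \<^term>\<open>dist x base_point\<close> compensates for the growth of the functions being multiplied.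
\<close>

definition lip_multiplier :: "real \<Rightarrow> ('a::pointed_metric_space \<Rightarrow> real) \<Rightarrow> bool"
  where "lip_multiplier B h \<longleftrightarrow>
    (\<forall>x. \<bar>h x\<bar> \<le> B) \<and> (\<forall>x y. \<bar>h x - h y\<bar> * dist x base_point \<le> B * dist x y)"

definition lip0_mult :: "('a::pointed_metric_space \<Rightarrow> real) \<Rightarrow> 'a lip0 \<Rightarrow> 'a lip0"
  where "lip0_mult h f = Lip0 (\<lambda>x. h x * apply_lip0 f x)"

lemma lip_multiplier_nonneg: "lip_multiplier B h \<Longrightarrow> 0 \<le> B"
  unfolding lip_multiplier_def by (meson abs_ge_zero order_trans)

lemma
  assumes "lip_multiplier B h"
  shows apply_lip0_mult: "apply_lip0 (lip0_mult h f) x = h x * apply_lip0 f x"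
    and norm_lip0_mult_le: "norm (lip0_mult h f) \<le> 2 * B * norm f"
proof -
  have B: "0 \<le> B" using assms by (rule lip_multiplier_nonneg)
  have b: "\<bar>h x * apply_lip0 f x - h y * apply_lip0 f y\<bar> \<le> 2 * B * norm f * dist x y" for x y
  proof -
    have "h x * apply_lip0 f x - h y * apply_lip0 f y =
        (h x - h y) * apply_lip0 f x + h y * (apply_lip0 f x - apply_lip0 f y)"
      by (simp add: algebra_simps)
    also have "\<bar>\<dots>\<bar> \<le> \<bar>h x - h y\<bar> * \<bar>apply_lip0 f x\<bar> + \<bar>h y\<bar> * \<bar>apply_lip0 f x - apply_lip0 f y\<bar>"
      by (metis abs_mult abs_triangle_ineq)
    also have "\<dots> \<le> \<bar>h x - h y\<bar> * (norm f * dist x base_point) + B * (norm f * dist x y)"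
      using assms B unfolding lip_multiplier_def
      by (intro add_mono mult_mono abs_apply_lip0_le abs_apply_lip0_diff_le) auto
    also have "\<dots> \<le> norm f * (B * dist x y) + B * (norm f * dist x y)"
    proof -
      have "norm f * (\<bar>h x - h y\<bar> * dist x base_point) \<le> norm f * (B * dist x y)"
        using assms unfolding lip_multiplier_def by (intro mult_left_mono) auto
      then show ?thesis by (simp add: ac_simps)
    qed
    finally show ?thesis by (simp add: algebra_simps)
  qed
  show "apply_lip0 (lip0_mult h f) x = h x * apply_lip0 f x"
    unfolding lip0_mult_def by (subst apply_Lip0[OF _ b]) (use B in auto)
  show "norm (lip0_mult h f) \<le> 2 * B * norm f"
    unfolding lip0_mult_def by (rule norm_Lip0_le[OF _ b]) (use B in auto)
qed

text \<open>Within distance \<open>R\<close> of the base point the slope \<open>L\<close> costs at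
  most \<open>L * R\<close>. If \<open>x\<close> lies beyond \<open>R\<close> and \<open>h y\<close>
  is nonzero, then \<open>dist x base_point\<close> exceeds \<open>R\<close> by at most
  \<open>dist x y\<close>, and this excess is multiplied only by \<open>|h y| \<le> 1\<close>; hence
  the summand 1.\<close>

lemma lip_multiplier_bounded_support:
  fixes h :: "'a::pointed_metric_space \<Rightarrow> real"
  assumes "0 \<le> L" "0 \<le> R" "\<And>x. \<bar>h x\<bar> \<le> 1"
    and L: "\<And>x y. \<bar>h x - h y\<bar> \<le> L * dist x y"
    and supp: "\<And>x. h x \<noteq> 0 \<Longrightarrow> dist x base_point \<le> R"
  shows "lip_multiplier (L * R + 1) h"
  unfolding lip_multiplier_def
proof (intro conjI allI)
  show "\<bar>h x\<bar> \<le> L * R + 1" for x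
    using assms(1,2) assms(3)[of x] by (simp add: add_increasing)
  fix x y :: 'a
  have LR: "\<bar>h x - h y\<bar> * R \<le> L * dist x y * R"
    using L assms(2) by (rule mult_right_mono)
  show "\<bar>h x - h y\<bar> * dist x base_point \<le> (L * R + 1) * dist x y"
  proof (cases "dist x base_point \<le> R")
    case True
    then have "\<bar>h x - h y\<bar> * dist x base_point \<le> \<bar>h x - h y\<bar> * R"
      by (intro mult_left_mono) auto
    also note LR
    also have "L * dist x y * R \<le> (L * R + 1) * dist x y" by (simp add: algebra_simps)
    finally show ?thesis .
  next
    case False
    then have hx: "h x = 0" using supp by blast
    show ?thesis
    proof (cases "h y = 0")
      case True
      then show ?thesis using hx assms by simp
    next
      case False
      then have "dist x base_point \<le> R + dist x y"
        using supp[of y] dist_triangle[of x base_point y] by linarith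
      then have "\<bar>h x - h y\<bar> * dist x base_point \<le> \<bar>h x - h y\<bar> * (R + dist x y)"
        by (intro mult_left_mono) auto
      also have "\<dots> = \<bar>h x - h y\<bar> * R + \<bar>h y\<bar> * dist x y" using hx by (simp add: algebra_simps)
      also have "\<dots> \<le> L * dist x y * R + 1 * dist x y"
        by (rule add_mono[OF LR mult_right_mono]) (use assms(3) in auto)
      finally show ?thesis by (simp add: algebra_simps)
    qed
  qed
qed

section \<open>Bump functions\<close>

definition bump :: "'a::metric_space \<Rightarrow> real \<Rightarrow> 'a \<Rightarrow> real"
  where "bump x r y = max 0 (min 1 (2 - dist x y / r))"

lemma bump_bounds: "0 \<le> bump x r y" "bump x r y \<le> 1"
  by (auto simp: bump_def)

lemma bump_eq_1: "0 < r \<Longrightarrow> dist x y \<le> r \<Longrightarrow> bump x r y = 1"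
  by (simp add: bump_def field_simps)

lemma bump_eq_0: "0 < r \<Longrightarrow> 2 * r \<le> dist x y \<Longrightarrow> bump x r y = 0"
  by (simp add: bump_def field_simps)

lemma bump_lipschitz:
  assumes "0 < r"
  shows "\<bar>bump x r y - bump x r z\<bar> \<le> (1 / r) * dist y z"
proof -
  have "\<bar>bump x r y - bump x r z\<bar> \<le> \<bar>dist x y / r - dist x z / r\<bar>"
    by (auto simp: bump_def)
  also have "\<dots> = \<bar>dist x y - dist x z\<bar> / r"
    using assms by (simp flip: diff_divide_distrib)
  also have "\<dots> \<le> dist y z / r"
    using assms dist_triangle[of x y z] dist_triangle[of x z y]
    by (intro divide_right_mono) (auto simp: dist_commute)
  finally show ?thesis by simp
qed

text \<open>The bump has slope \<open>1 / r\<close> and lives within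
  \<open>2 * r + dist x base_point\<close> of the base point. Centred at the base point, its
  constant is 3 whatever the radius, which later bounds cut-offs on growing balls uniformly.\<close>

lemma lip_multiplier_bump:
  assumes "0 < r"
  shows "lip_multiplier (3 + dist x base_point / r) (bump x r)"
proof -
  have "lip_multiplier (1 / r * (2 * r + dist x base_point) + 1) (bump x r)"
  proof (rule lip_multiplier_bounded_support)
    fix y assume "bump x r y \<noteq> 0"
    then have "dist x y < 2 * r" using bump_eq_0[OF assms, of x y] by linarith
    then show "dist y base_point \<le> 2 * r + dist x base_point"
      using dist_triangle[of y base_point x] by (simp add: dist_commute)
  qed (use assms bump_bounds[of x r] bump_lipschitz[OF assms] in auto)
  moreover have "1 / r * (2 * r + dist x base_point) + 1 = 3 + dist x base_point / r"
    using assms by (simp add: field_simps)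
  ultimately show ?thesis by simp
qed

lemma apply_lip0_mult_bump:
  "0 < r \<Longrightarrow> apply_lip0 (lip0_mult (bump x r) f) y = bump x r y * apply_lip0 f y"
  by (rule apply_lip0_mult[OF lip_multiplier_bump])

text \<open>The adjoint of multiplication by \<open>h\<close>, an analogue of the measure with
  density \<open>h\<close>. \<open>Blinfun\<close> determines it only when multiplication by
  \<open>h\<close> is bounded and linear.\<close>

definition lf_weight ::
    "('a::pointed_metric_space \<Rightarrow> real) \<Rightarrow> ('a lip0 \<Rightarrow>\<^sub>L real) \<Rightarrow> 'a lip0 \<Rightarrow>\<^sub>L real"
  where "lf_weight h \<mu> = \<mu> o\<^sub>L Blinfun (lip0_mult h)"

lemma bounded_linear_lip0_mult:
  assumes "lip_multiplier B h"
  shows "bounded_linear (lip0_mult h)"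
proof (rule bounded_linear_intro)
  show "norm (lip0_mult h f) \<le> norm f * (2 * B)" for f
    using norm_lip0_mult_le[OF assms, of f] by (simp add: mult.commute)
qed (auto intro!: lip0_eqI simp: apply_lip0_simps apply_lip0_mult[OF assms] algebra_simps)

lemma lf_weight_apply:
  "lip_multiplier B h \<Longrightarrow> blinfun_apply (lf_weight h \<mu>) f = blinfun_apply \<mu> (lip0_mult h f)"
  by (simp add: lf_weight_def bounded_linear_Blinfun_apply[OF bounded_linear_lip0_mult])

lemmas lf_weight_bump_apply = lf_weight_apply[OF lip_multiplier_bump]

section \<open>The closed subspaces \<open>lipfree_on K\<close>\<close>

lemma lipfree_on_mono: "K \<subseteq> K' \<Longrightarrow> lipfree_on K \<subseteq> lipfree_on K'"
  unfolding lipfree_on_def by (intro closure_mono span_mono image_mono)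

lemma subspace_lipfree_on: "subspace (lipfree_on K)"
proof (rule subspaceI)
  let ?S = "span (lf_delta ` K)"
  show "0 \<in> lipfree_on K"
    unfolding lipfree_on_def by (rule subsetD[OF closure_subset span_zero])
  show "a + b \<in> lipfree_on K" if "a \<in> lipfree_on K" "b \<in> lipfree_on K" for a b
  proof -
    from that obtain u v where "\<And>n. u n \<in> ?S" "u \<longlonglongrightarrow> a" "\<And>n. v n \<in> ?S" "v \<longlonglongrightarrow> b"
      unfolding lipfree_on_def closure_sequential by blast
    then have "\<And>n. u n + v n \<in> ?S" "(\<lambda>n. u n + v n) \<longlonglongrightarrow> a + b"
      by (auto intro: span_add tendsto_add)
    then show ?thesis unfolding lipfree_on_def closure_sequential
      by (intro exI[of _ "\<lambda>n. u n + v n"]) auto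
  qed
  show "c *\<^sub>R a \<in> lipfree_on K" if "a \<in> lipfree_on K" for c a
  proof -
    from that obtain u where "\<And>n. u n \<in> ?S" "u \<longlonglongrightarrow> a"
      unfolding lipfree_on_def closure_sequential by blast
    then have "\<And>n. c *\<^sub>R u n \<in> ?S" "(\<lambda>n. c *\<^sub>R u n) \<longlonglongrightarrow> c *\<^sub>R a"
      by (auto intro: span_scale tendsto_scaleR)
    then show ?thesis unfolding lipfree_on_def closure_sequential
      by (intro exI[of _ "\<lambda>n. c *\<^sub>R u n"]) auto
  qed
qed

lemma lf_delta_in_lipfree_on: "x \<in> K \<Longrightarrow> lf_delta x \<in> lipfree_on K"
  unfolding lipfree_on_def by (rule subsetD[OF closure_subset span_base[OF imageI]])

text \<open>Weighting is bounded and linear in \<mu> and maps \<open>lf_delta x\<close> to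
  \<open>h x *\<^sub>R lf_delta x\<close>, which is 0 off \<open>K\<close>. The inclusion passes to
  spans and, by continuity, to closures.\<close>

lemma lf_weight_in_lipfree_on:
  assumes "lip_multiplier B h" "\<mu> \<in> lipfree" "\<And>x. x \<notin> K \<Longrightarrow> h x = 0"
  shows "lf_weight h \<mu> \<in> lipfree_on K"
proof -
  have bl: "bounded_linear (lf_weight h)"
    unfolding lf_weight_def
    by (rule bounded_bilinear.bounded_linear_left[OF bounded_bilinear_blinfun_compose])
  have "lf_weight h (lf_delta x) = h x *\<^sub>R lf_delta x" for x
    by (rule blinfun_eqI)
      (simp add: lf_weight_apply[OF assms(1)] apply_lip0_mult[OF assms(1)] blinfun.scaleR_left)
  moreover have "h x *\<^sub>R lf_delta x \<in> span (lf_delta ` K)" for x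
    by (cases "x \<in> K") (simp_all add: assms(3) span_zero span_scale span_base)
  ultimately have "lf_weight h ` range lf_delta \<subseteq> span (lf_delta ` K)"
    by (simp add: image_subset_iff)
  then have "span (lf_weight h ` range lf_delta) \<subseteq> span (lf_delta ` K)"
    by (rule span_minimal[OF _ subspace_span])
  then have "lf_weight h ` span (range lf_delta) \<subseteq> span (lf_delta ` K)"
    by (simp only: linear_span_image[OF bounded_linear.linear[OF bl]])
  then have "lf_weight h ` closure (span (range lf_delta)) \<subseteq> closure (span (lf_delta ` K))"
    by (intro order_trans[OF closure_bounded_linear_image_subset[OF bl]] closure_mono)
  then show ?thesis
    using assms(2) unfolding lipfree_on_def by (simp only: image_subset_iff)
qed

section \<open>Continuity and locality of elements of the free space\<close>

lemma lipfree_on_eq_0: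
  assumes "\<mu> \<in> lipfree_on K" "\<And>x. x \<in> K \<Longrightarrow> apply_lip0 f x = 0"
  shows "blinfun_apply \<mu> f = 0"
proof -
  have "span (lf_delta ` K) \<subseteq> {v. blinfun_apply v f = 0}"
    by (rule span_minimal)
      (auto simp: assms(2) subspace_def blinfun.add_left blinfun.scaleR_left)
  moreover have "closed {v. blinfun_apply v f = 0}"
    by (intro closed_Collect_eq continuous_intros)
  ultimately have "closure (span (lf_delta ` K)) \<subseteq> {v. blinfun_apply v f = 0}"
    by (rule closure_minimal)
  with assms(1) show ?thesis unfolding lipfree_on_def by auto
qed

lemma lipfree_approx:
  assumes "\<mu> \<in> lipfree" "0 < \<epsilon>"
  obtains v E where "norm (\<mu> - v) < \<epsilon>" "finite E"
    "\<And>f. (\<And>x. x \<in> E \<Longrightarrow> apply_lip0 f x = 0) \<Longrightarrow> blinfun_apply v f = 0"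
proof -
  obtain v where v: "v \<in> span (range lf_delta)" "dist v \<mu> < \<epsilon>"
    using assms unfolding lipfree_on_def closure_approachable by blast
  then obtain T r where T: "finite T" "T \<subseteq> range lf_delta" "v = (\<Sum>a\<in>T. r a *\<^sub>R a)"
    unfolding span_explicit by blast
  obtain E where E: "finite E" "T = lf_delta ` E"
    using T(1,2) finite_subset_image by metis
  show thesis
  proof
    show "norm (\<mu> - v) < \<epsilon>" using v(2) by (simp add: dist_norm norm_minus_commute)
    show "blinfun_apply v f = 0" if "\<And>x. x \<in> E \<Longrightarrow> apply_lip0 f x = 0" for f
      unfolding T(3) E(2) blinfun.sum_left
      by (rule sum.neutral) (auto simp: that blinfun.scaleR_left)
  qed fact
qed

text \<open>Weak-star continuity on bounded sequences: it is clear for combinations of evaluations,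
  and the uniform bound \<open>C\<close> carries it over to their norm limits.\<close>

lemma lipfree_tendsto_0:
  fixes f :: "nat \<Rightarrow> 'a::pointed_metric_space lip0"
  assumes "\<mu> \<in> lipfree" "\<And>n. norm (f n) \<le> C"
    and "\<And>x. (\<lambda>n. apply_lip0 (f n) x) \<longlonglongrightarrow> 0"
  shows "(\<lambda>n. blinfun_apply \<mu> (f n)) \<longlonglongrightarrow> 0"
proof (rule LIMSEQ_I)
  fix e :: real assume e: "0 < e"
  have C: "0 \<le> C" using assms(2)[of 0] norm_ge_zero order_trans by blast
  \<comment> \<open>Replacing \<mu> by \<open>v\<close> then costs at most
    \<open>d * C \<le> e / 2\<close>; the summand 1 covers \<open>C = 0\<close>.\<close>
  define d where "d = e / (2 * (C + 1))"
  have d: "0 < d" using e C by (simp add: d_def)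
  obtain v where v: "v \<in> span (range lf_delta)" "dist v \<mu> < d"
    using assms(1) d unfolding lipfree_on_def closure_approachable by blast
  have "span (range lf_delta) \<subseteq> {v. (\<lambda>n. blinfun_apply v (f n)) \<longlonglongrightarrow> 0}"
    by (rule span_minimal)
      (auto simp: assms(3) subspace_def blinfun.add_left blinfun.scaleR_left
        intro: tendsto_add_zero tendsto_mult_right_zero)
  with v have "(\<lambda>n. blinfun_apply v (f n)) \<longlonglongrightarrow> 0" by blast
  then obtain N where N: "\<And>n. n \<ge> N \<Longrightarrow> \<bar>blinfun_apply v (f n)\<bar> < e / 2"
    using LIMSEQ_D[of _ 0 "e / 2"] e by fastforce
  have "\<bar>blinfun_apply \<mu> (f n)\<bar> < e" if "n \<ge> N" for n
  proof -
    have "\<bar>blinfun_apply (\<mu> - v) (f n)\<bar> \<le> norm (\<mu> - v) * norm (f n)"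
      using norm_blinfun[of "\<mu> - v" "f n"] by simp
    also have "\<dots> \<le> d * C"
      using v(2) assms(2) d by (intro mult_mono) (auto simp: dist_norm norm_minus_commute)
    also have "\<dots> \<le> e / 2"
      using C e by (simp add: d_def field_simps)
    finally show ?thesis using N[OF that] unfolding blinfun.diff_left by linarith
  qed
  then show "\<exists>N. \<forall>n\<ge>N. norm (blinfun_apply \<mu> (f n) - 0) < e" by auto
qed

text \<open>
  Approximate \<open>\<mu>\<close> by an element carried by a finite set \<open>E\<close> and split \<open>f\<close> into a part near \<open>E\<close> and a part
  vanishing on \<open>E\<close>. The Lipschitz constant of the latter depends on \<open>d\<close> and \<open>R\<close> but not on \<open>E\<close>, so the
  approximation can be chosen fine enough for \<open>\<mu>\<close> to detect the part near \<open>E\<close>.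
\<close>

lemma lipfree_localize:
  fixes \<mu> :: "'a::pointed_metric_space lip0 \<Rightarrow>\<^sub>L real"
  assumes "\<mu> \<in> lipfree" "blinfun_apply \<mu> f \<noteq> 0" "0 < d"
    and supp: "\<And>y. apply_lip0 f y \<noteq> 0 \<Longrightarrow> dist y base_point \<le> R"
  obtains x g where "blinfun_apply \<mu> g \<noteq> 0"
    "\<And>y. apply_lip0 g y \<noteq> 0 \<Longrightarrow> apply_lip0 f y \<noteq> 0 \<and> dist x y < 2 * d"
proof (rule ccontr)
  note that' = that
  assume "\<not> thesis"
  then have null: "blinfun_apply \<mu> g = 0"
    if "\<And>y. apply_lip0 g y \<noteq> 0 \<Longrightarrow> apply_lip0 f y \<noteq> 0 \<and> dist x y < 2 * d" for x g
    using that that' by blast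
  have R: "0 \<le> R"
  proof -
    obtain y where "apply_lip0 f y \<noteq> 0"
      using assms(2) by (metis blinfun.zero_right lip0_eqI zero_lip0.rep_eq)
    then show ?thesis using supp zero_le_dist order_trans by blast
  qed
  \<comment> \<open>A Lipschitz constant for \<open>f\<close> times a cut-off of slope
    \<open>1 / d\<close>, since \<open>|f| \<le> norm f * R\<close> everywhere.\<close>
  define C where "C = norm f * (1 + R / d)"
  have C: "0 \<le> C" using R assms(3) by (simp add: C_def)
  define \<epsilon> where "\<epsilon> = \<bar>blinfun_apply \<mu> f\<bar> / (C + 1)"
  have "0 < \<epsilon>" using assms(2) C by (simp add: \<epsilon>_def)
  then obtain v E0 where v: "norm (\<mu> - v) < \<epsilon>" "finite E0"
      "\<And>f. (\<And>x. x \<in> E0 \<Longrightarrow> apply_lip0 f x = 0) \<Longrightarrow> blinfun_apply v f = 0"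
    using lipfree_approx[OF assms(1)] by metis
  \<comment> \<open>The base point keeps \<open>E\<close> nonempty: \<open>infdist\<close> to the
    empty set is 0 by convention, and the cut-off below would then vanish everywhere.\<close>
  define E where "E = insert base_point E0"
  have E: "finite E" "E \<noteq> {}" using v(2) by (auto simp: E_def)
  define k where "k = (\<lambda>y. min 1 (infdist y E / d))"
  have k_bounds: "0 \<le> k y" "k y \<le> 1" for y
    using assms(3) by (auto simp: k_def infdist_nonneg)
  have k_lip: "\<bar>k x - k y\<bar> \<le> (1 / d) * dist x y" for x y
  proof -
    have "\<bar>k x - k y\<bar> \<le> \<bar>infdist x E / d - infdist y E / d\<bar>" by (auto simp: k_def)
    also have "\<dots> = \<bar>infdist x E - infdist y E\<bar> / d"
      using assms(3) by (simp flip: diff_divide_distrib)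
    also have "\<dots> \<le> dist x y / d"
      using assms(3) infdist_triangle_abs[of x E y] by (intro divide_right_mono) auto
    finally show ?thesis by simp
  qed
  have kf: "\<bar>k x * apply_lip0 f x - k y * apply_lip0 f y\<bar> \<le> C * dist x y" for x y
  proof -
    have "\<bar>apply_lip0 f y\<bar> \<le> norm f * R"
    proof (cases "apply_lip0 f y = 0")
      case False
      have "\<bar>apply_lip0 f y\<bar> \<le> norm f * dist y base_point" by (rule abs_apply_lip0_le)
      also have "\<dots> \<le> norm f * R" using supp[OF False] by (intro mult_left_mono) auto
      finally show ?thesis .
    qed (use R in auto)
    then have "\<bar>k x\<bar> * \<bar>apply_lip0 f x - apply_lip0 f y\<bar> + \<bar>k x - k y\<bar> * \<bar>apply_lip0 f y\<bar>
        \<le> 1 * (norm f * dist x y) + ((1 / d) * dist x y) * (norm f * R)"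
      using k_bounds assms(3)
      by (intro add_mono mult_mono k_lip abs_apply_lip0_diff_le) auto
    moreover have "\<bar>k x * apply_lip0 f x - k y * apply_lip0 f y\<bar>
        \<le> \<bar>k x\<bar> * \<bar>apply_lip0 f x - apply_lip0 f y\<bar> + \<bar>k x - k y\<bar> * \<bar>apply_lip0 f y\<bar>"
    proof -
      have "k x * apply_lip0 f x - k y * apply_lip0 f y
          = k x * (apply_lip0 f x - apply_lip0 f y) + (k x - k y) * apply_lip0 f y"
        by (simp add: algebra_simps)
      then show ?thesis by (metis abs_mult abs_triangle_ineq)
    qed
    ultimately show ?thesis by (simp add: C_def algebra_simps)
  qed
  define g where "g = Lip0 (\<lambda>x. k x * apply_lip0 f x)"
  have g: "apply_lip0 g = (\<lambda>x. k x * apply_lip0 f x)" "norm g \<le> C"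
    unfolding g_def using C kf by (auto intro!: apply_Lip0 norm_Lip0_le)
  have "blinfun_apply v g = 0"
    by (rule v(3)) (simp add: g(1) k_def E_def)
  then have "\<bar>blinfun_apply \<mu> g\<bar> = \<bar>blinfun_apply (\<mu> - v) g\<bar>" by (simp add: blinfun.diff_left)
  also have "\<dots> \<le> norm (\<mu> - v) * norm g"
    using norm_blinfun[of "\<mu> - v" g] by simp
  also have "\<dots> \<le> \<epsilon> * C" using v(1) g(2) \<open>0 < \<epsilon>\<close> by (intro mult_mono) auto
  also have "\<dots> < \<bar>blinfun_apply \<mu> f\<bar>"
    using assms(2) C by (simp add: \<epsilon>_def field_simps)
  finally have lt: "\<bar>blinfun_apply \<mu> g\<bar> < \<bar>blinfun_apply \<mu> f\<bar>" .
  \<comment> \<open>Peel off one centre at a time: multiplying by \<open>bump a d\<close> gives a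
    function that \<open>null\<close> handles, and the remainder vanishes within \<open>d\<close> of
    \<open>a\<close>, so it is supported near the other centres only.\<close>
  have near: "blinfun_apply \<mu> u = 0"
    if "finite A" "\<And>y. apply_lip0 u y \<noteq> 0 \<Longrightarrow> apply_lip0 f y \<noteq> 0 \<and> (\<exists>e\<in>A. dist e y < d)" for A u
    using that
  proof (induction A arbitrary: u)
    case empty
    then have "u = 0" by (intro lip0_eqI) (auto simp: apply_lip0_simps)
    then show ?case by simp
  next
    case (insert a A)
    let ?w = "lip0_mult (bump a d) u"
    note w = apply_lip0_mult_bump[OF assms(3)]
    have "blinfun_apply \<mu> ?w = 0"
    proof (rule null)
      fix y assume "apply_lip0 ?w y \<noteq> 0"
      then have "apply_lip0 u y \<noteq> 0" "bump a d y \<noteq> 0" by (auto simp: w)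
      then show "apply_lip0 f y \<noteq> 0 \<and> dist a y < 2 * d"
        using insert.prems bump_eq_0[OF assms(3), of a y] by force
    qed
    moreover have "blinfun_apply \<mu> (u - ?w) = 0"
    proof (rule insert.IH)
      fix y assume "apply_lip0 (u - ?w) y \<noteq> 0"
      then have "apply_lip0 u y \<noteq> 0" "bump a d y \<noteq> 1" by (auto simp: w apply_lip0_simps)
      then show "apply_lip0 f y \<noteq> 0 \<and> (\<exists>e\<in>A. dist e y < d)"
        using insert.prems[of y] bump_eq_1[OF assms(3), of a y] by auto
    qed
    ultimately show ?case by (simp add: blinfun.diff_right)
  qed
  have "blinfun_apply \<mu> (f - g) = 0"
  proof (rule near[OF E(1)])
    fix y assume "apply_lip0 (f - g) y \<noteq> 0"
    then have "apply_lip0 f y \<noteq> 0" "k y \<noteq> 1" by (auto simp: g(1) apply_lip0_simps)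
    then have "infdist y E < d" using assms(3) by (auto simp: k_def min_def field_simps split: if_splits)
    then have "\<exists>e\<in>E. dist y e < d"
      using cInf_lessD[of "dist y ` E" d] E by (auto simp: infdist_notempty)
    with \<open>apply_lip0 f y \<noteq> 0\<close> show "apply_lip0 f y \<noteq> 0 \<and> (\<exists>e\<in>E. dist e y < d)"
      by (simp add: dist_commute)
  qed
  with lt show False by (simp add: blinfun.diff_right)
qed

text \<open>Localizing repeatedly at scales \<open>(1/2) ^ n\<close> gives functions
  \<open>G n\<close> with shrinking supports on which \<mu> is nonzero. Points of these supports
  form a Cauchy sequence, and completeness yields the limit \<open>x\<close>. A bump around
  \<open>x\<close> is 1 on the support of some \<open>G n\<close>, so weighting by it does not
  annihilate \<mu>.\<close>

lemma lipfree_local_point: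
  fixes \<mu> :: "'a::{pointed_metric_space, complete_space} lip0 \<Rightarrow>\<^sub>L real"
  assumes "\<mu> \<in> lipfree" "blinfun_apply \<mu> f \<noteq> 0"
    and supp: "\<And>y. apply_lip0 f y \<noteq> 0 \<Longrightarrow> dist y base_point \<le> R"
  obtains x where "\<And>r. 0 < r \<Longrightarrow> lf_weight (bump x r) \<mu> \<noteq> 0"
    "\<And>r. 0 < r \<Longrightarrow> \<exists>y. dist x y < r \<and> apply_lip0 f y \<noteq> 0"
proof -
  define P where "P = (\<lambda>g. blinfun_apply \<mu> g \<noteq> 0 \<and> (\<forall>y. apply_lip0 g y \<noteq> 0 \<longrightarrow> apply_lip0 f y \<noteq> 0))"
  define Q where "Q = (\<lambda>(n::nat) (g::'a lip0) (h::'a lip0). \<exists>x. \<forall>y. apply_lip0 h y \<noteq> 0 \<longrightarrow>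
    apply_lip0 g y \<noteq> 0 \<and> dist x y < 2 * (1/2) ^ n)"
  have "\<exists>G. \<forall>n. P (G n) \<and> Q n (G n) (G (Suc n))"
  proof (rule dependent_nat_choice)
    show "\<exists>g. P g" using assms(2) by (auto simp: P_def)
    fix g n assume g: "P g"
    have "0 < (1/2 :: real) ^ n" by simp
    then obtain x h where h: "blinfun_apply \<mu> h \<noteq> 0"
        "\<And>y. apply_lip0 h y \<noteq> 0 \<Longrightarrow> apply_lip0 g y \<noteq> 0 \<and> dist x y < 2 * (1/2) ^ n"
      using lipfree_localize[OF assms(1), of g "(1/2) ^ n" R] g supp unfolding P_def by metis
    show "\<exists>h. P h \<and> Q n g h"
    proof (intro exI conjI)
      show "P h" using h g unfolding P_def by blast
      show "Q n g h" using h(2) unfolding Q_def by blast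
    qed
  qed
  then obtain G where G: "\<And>n. P (G n)" "\<And>n. Q n (G n) (G (Suc n))" by blast
  obtain X where X: "\<And>n y. apply_lip0 (G (Suc n)) y \<noteq> 0 \<Longrightarrow>
      apply_lip0 (G n) y \<noteq> 0 \<and> dist (X n) y < 2 * (1/2) ^ n"
    using G(2) unfolding Q_def by metis
  have "\<exists>y. apply_lip0 (G n) y \<noteq> 0" for n
    using G(1)[of n] unfolding P_def
    by (metis blinfun.zero_right lip0_eqI zero_lip0.rep_eq)
  then obtain Y where Y: "\<And>n. apply_lip0 (G n) (Y n) \<noteq> 0" by metis
  have anti: "apply_lip0 (G n) y \<noteq> 0" if "apply_lip0 (G m) y \<noteq> 0" "n \<le> m" for n m y
    using that(2,1) by (induction rule: dec_induct) (use X in blast)+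
  \<comment> \<open>The ball around \<open>X n\<close> contains the support of
    \<open>G (Suc n)\<close> and of all later functions, but not necessarily that of
    \<open>G n\<close>.\<close>
  have close: "dist (X n) (Y m) < 2 * (1/2) ^ n" if "Suc n \<le> m" for n m
    using X anti[OF Y that] by blast
  \<comment> \<open>Two radii \<open>2 * (1/2) ^ n\<close> add up in each of the triangle
    inequalities below.\<close>
  have small: "\<exists>n. 4 * (1/2) ^ n < (e::real)" if "0 < e" for e
    using real_arch_pow_inv[of "e / 4" "1/2"] that by (auto simp: field_simps)
  have "Cauchy Y"
  proof (rule metric_CauchyI)
    fix e :: real assume "0 < e"
    then obtain n where n: "4 * (1/2) ^ n < e" using small by blast
    have "dist (Y i) (Y j) < e" if "i \<ge> Suc n" "j \<ge> Suc n" for i j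
      using close[OF that(1)] close[OF that(2)] n dist_triangle3[of "Y i" "Y j" "X n"] by linarith
    then show "\<exists>M. \<forall>m\<ge>M. \<forall>n\<ge>M. dist (Y m) (Y n) < e" by blast
  qed
  then obtain x where x: "Y \<longlonglongrightarrow> x" using Cauchy_convergent convergent_def by blast
  have Xx: "dist (X n) x \<le> 2 * (1/2) ^ n" for n
    by (rule LIMSEQ_le_const2[OF tendsto_dist[OF tendsto_const x]])
      (use close less_imp_le in blast)
  have near: "\<exists>n. \<forall>y. apply_lip0 (G n) y \<noteq> 0 \<longrightarrow> dist x y < r" if r: "0 < r" for r
  proof -
    obtain n where n: "4 * (1/2) ^ n < r" using small[OF r] by blast
    have "dist x y < r" if "apply_lip0 (G (Suc n)) y \<noteq> 0" for y
      using X[OF that] Xx[of n] n dist_triangle3[of x y "X n"] by linarith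
    then show ?thesis by blast
  qed
  show thesis
  proof
    fix r :: real assume r: "0 < r"
    from near[OF r] obtain n where n: "\<And>y. apply_lip0 (G n) y \<noteq> 0 \<Longrightarrow> dist x y < r" by blast
    then show "\<exists>y. dist x y < r \<and> apply_lip0 f y \<noteq> 0"
      using Y[of n] G(1)[of n] unfolding P_def by blast
    have "lip0_mult (bump x r) (G n) = G n"
    proof (rule lip0_eqI)
      fix y
      show "apply_lip0 (lip0_mult (bump x r) (G n)) y = apply_lip0 (G n) y"
        using n[of y] bump_eq_1[OF r, of x y]
        by (cases "apply_lip0 (G n) y = 0") (auto simp: apply_lip0_mult_bump[OF r])
    qed
    then have "blinfun_apply (lf_weight (bump x r) \<mu>) (G n) \<noteq> 0"
      using G(1)[of n] by (simp add: lf_weight_bump_apply[OF r] P_def)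
    then show "lf_weight (bump x r) \<mu> \<noteq> 0" by auto
  qed
qed

section \<open>Supports of elements of the free space\<close>

lemma not_in_lf_supp:
  assumes "x \<notin> lf_supp \<mu>"
  obtains r where "0 < r" "\<mu> \<in> lipfree_on (- ball x r)"
proof -
  obtain K where K: "closed K" "\<mu> \<in> lipfree_on K" "x \<notin> K"
    using assms by (auto simp: lf_supp_def)
  then obtain r where "0 < r" "ball x r \<subseteq> - K"
    using open_contains_ball[of "- K"] by auto
  with that K(2) lipfree_on_mono[of K "- ball x r"] show thesis by blast
qed

text \<open>The support is only an intersection of carrying sets, so this needs a local argument. If
  \<mu> does not vanish at \<open>f\<close>, it does not vanish at some \<open>u k\<close> of
  bounded support that is 0 wherever \<open>|f|\<close> is small. A local point of
  \<open>u k\<close> cannot lie in the support, near which \<open>f\<close> is small, nor outside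
  it, where small bumps annihilate \<mu>.\<close>

lemma vanishes_on_lf_supp:
  fixes \<mu> :: "'a::{pointed_metric_space, complete_space} lip0 \<Rightarrow>\<^sub>L real"
  assumes "\<mu> \<in> lipfree" and f: "\<And>x. x \<in> lf_supp \<mu> \<Longrightarrow> apply_lip0 f x = 0"
  shows "blinfun_apply \<mu> f = 0"
proof (rule ccontr)
  assume ne: "blinfun_apply \<mu> f \<noteq> 0"
  \<comment> \<open>Truncating \<open>f\<close> to values of size at most
    \<open>inverse (Suc n)\<close> does not increase the Lipschitz constant, and the truncations
    tend to 0 pointwise.\<close>
  define c where "c = (\<lambda>n::nat. Lip0 (\<lambda>x. max (- inverse (Suc n)) (min (inverse (Suc n)) (apply_lip0 f x))))"
  have "\<bar>max (- inverse (Suc n)) (min (inverse (Suc n)) (apply_lip0 f x)) -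
      max (- inverse (Suc n)) (min (inverse (Suc n)) (apply_lip0 f y))\<bar> \<le> norm f * dist x y" for n x y
    using abs_apply_lip0_diff_le[of f x y] by linarith
  then have c: "apply_lip0 (c n) = (\<lambda>x. max (- inverse (Suc n)) (min (inverse (Suc n)) (apply_lip0 f x)))"
      "norm (c n) \<le> norm f" for n
    unfolding c_def by (auto intro!: apply_Lip0[of "norm f"] norm_Lip0_le)
  have "(\<lambda>n. blinfun_apply \<mu> (c n)) \<longlonglongrightarrow> 0"
  proof (rule lipfree_tendsto_0[OF assms(1) c(2)])
    fix x
    show "(\<lambda>n. apply_lip0 (c n) x) \<longlonglongrightarrow> 0"
    proof (rule Lim_null_comparison[OF always_eventually LIMSEQ_inverse_real_of_nat], intro allI)
      fix n
      have "0 < inverse (real (Suc n))" by simp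
      then show "norm (apply_lip0 (c n) x) \<le> inverse (real (Suc n))"
        unfolding c real_norm_def by linarith
    qed
  qed
  then have "\<exists>n. norm (blinfun_apply \<mu> (c n) - 0) < \<bar>blinfun_apply \<mu> f\<bar>"
    using LIMSEQ_D ne by (metis order_refl zero_less_abs_iff)
  then obtain n where "\<bar>blinfun_apply \<mu> (c n)\<bar> < \<bar>blinfun_apply \<mu> f\<bar>" by auto
  define g where "g = f - c n"
  have g: "blinfun_apply \<mu> g \<noteq> 0"
    using \<open>\<bar>blinfun_apply \<mu> (c n)\<bar> < _\<close> by (auto simp: g_def blinfun.diff_right)
  define \<epsilon> where "\<epsilon> = inverse (real (Suc n))"
  have \<epsilon>: "0 < \<epsilon>" by (simp add: \<epsilon>_def)
  have g0: "apply_lip0 g y = 0" if "\<bar>apply_lip0 f y\<bar> \<le> \<epsilon>" for y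
    using that unfolding g_def apply_lip0_simps c \<epsilon>_def by linarith
  \<comment> \<open>Cut off to bounded sets; the multiplier constant 3 gives
    \<open>norm (u k) \<le> 6 * norm g\<close> for every \<open>k\<close>.\<close>
  define u where "u = (\<lambda>k::nat. lip0_mult (bump base_point (Suc k)) g)"
  have u: "apply_lip0 (u k) y = bump base_point (Suc k) y * apply_lip0 g y" for k y
    unfolding u_def by (rule apply_lip0_mult_bump) simp
  have "(\<lambda>k. blinfun_apply \<mu> (g - u k)) \<longlonglongrightarrow> 0"
  proof (rule lipfree_tendsto_0[OF assms(1)])
    fix k
    have "norm (u k) \<le> 2 * 3 * norm g"
      using norm_lip0_mult_le[OF lip_multiplier_bump[of "Suc k" base_point], of g]
      by (simp add: u_def)
    then show "norm (g - u k) \<le> 7 * norm g"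
      using norm_triangle_ineq4[of g "u k"] by linarith
  next
    fix x :: 'a
    obtain N :: nat where N: "dist base_point x \<le> N" using real_arch_simple by blast
    have "apply_lip0 (g - u k) x = 0" if "N \<le> k" for k
      using N that bump_eq_1[of "Suc k" base_point x] by (simp add: apply_lip0_simps u)
    then show "(\<lambda>k. apply_lip0 (g - u k) x) \<longlonglongrightarrow> 0"
      by (intro tendsto_eventually) (auto simp: eventually_sequentially)
  qed
  then have "\<exists>k. norm (blinfun_apply \<mu> (g - u k) - 0) < \<bar>blinfun_apply \<mu> g\<bar>"
    using LIMSEQ_D g by (metis order_refl zero_less_abs_iff)
  then obtain k where k: "blinfun_apply \<mu> (u k) \<noteq> 0" by (force simp: blinfun.diff_right)
  have "dist y base_point \<le> 2 * Suc k" if "apply_lip0 (u k) y \<noteq> 0" for y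
    using that bump_eq_0[of "Suc k" base_point y]
    by (cases "2 * Suc k \<le> dist y base_point") (auto simp: u dist_commute)
  then obtain x where x: "\<And>r. 0 < r \<Longrightarrow> lf_weight (bump x r) \<mu> \<noteq> 0"
      "\<And>r. 0 < r \<Longrightarrow> \<exists>y. dist x y < r \<and> apply_lip0 (u k) y \<noteq> 0"
    using lipfree_local_point[OF assms(1) k] by blast
  show False
  proof (cases "x \<in> lf_supp \<mu>")
    case True
    \<comment> \<open>Within this distance of a zero of \<open>f\<close> one has
      \<open>|f| \<le> \<epsilon>\<close>, so that \<open>g\<close> vanishes.\<close>
    have "0 < \<epsilon> / (norm f + 1)" using \<epsilon> by (simp add: add_nonneg_pos)
    then obtain y where y: "dist x y < \<epsilon> / (norm f + 1)" "apply_lip0 (u k) y \<noteq> 0"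
      using x(2) by blast
    have "\<bar>apply_lip0 f y\<bar> \<le> norm f * dist x y"
      using abs_apply_lip0_diff_le[of f x y] f[OF True] by simp
    also have "\<dots> \<le> norm f * (\<epsilon> / (norm f + 1))" using y(1) by (intro mult_left_mono) auto
    also have "\<dots> \<le> \<epsilon>" using \<epsilon> by (simp add: divide_simps add_nonneg_pos mult_right_mono)
    finally show False using g0 y(2) by (simp add: u)
  next
    case False
    then obtain r where r: "0 < r" "\<mu> \<in> lipfree_on (- ball x r)" by (rule not_in_lf_supp)
    \<comment> \<open>Half the radius, because a bump reaches out to twice its radius.\<close>
    have r2: "0 < r / 2" using r by simp
    have "lf_weight (bump x (r / 2)) \<mu> = 0"
    proof (rule blinfun_eqI)
      fix h
      have "blinfun_apply \<mu> (lip0_mult (bump x (r / 2)) h) = 0"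
        by (rule lipfree_on_eq_0[OF r(2)])
          (simp add: apply_lip0_mult_bump[OF r2] bump_eq_0[OF r2])
      then show "blinfun_apply (lf_weight (bump x (r / 2)) \<mu>) h = blinfun_apply 0 h"
        by (simp add: lf_weight_bump_apply[OF r2])
    qed
    with x(1)[OF r2] show False by simp
  qed
qed

section \<open>Lagrange multipliers on symmetric convex sets\<close>

text \<open>The number \<open>- m\<close> has to lie above all quotients
  \<open>(\<Phi> x - c) / L x\<close> with \<open>L x > 0\<close> and below all those with
  \<open>L x < 0\<close>; \<open>cross\<close> shows that the former never exceed the latter. By
  symmetry of \<open>X\<close> either both signs of \<open>L\<close> occur or \<open>L\<close>
  vanishes on \<open>X\<close>.\<close>

lemma lagrange_multiplier:
  fixes X :: "'v::real_vector set" and L \<Phi> :: "'v \<Rightarrow> real"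
  assumes X: "convex X" "\<And>x. x \<in> X \<Longrightarrow> - x \<in> X"
    and "linear L" "linear \<Phi>"
    and le: "\<And>x. x \<in> X \<Longrightarrow> L x = 0 \<Longrightarrow> \<Phi> x \<le> c"
  obtains m where "\<And>x. x \<in> X \<Longrightarrow> \<Phi> x + m * L x \<le> c"
proof (cases "\<exists>x\<in>X. 0 < L x")
  case False
  have "L x = 0" if "x \<in> X" for x
    using False that X(2)[OF that] linear_neg[OF assms(3), of x]
    by (metis linorder_neqE_linordered_idom neg_0_less_iff_less)
  then show thesis using le that[of 0] by simp
next
  case True
  have cross: "(\<Phi> x - c) / L x \<le> (\<Phi> y - c) / L y"
    if xy: "x \<in> X" "y \<in> X" "0 < L x" "L y < 0" for x y
  proof -
    define s where "s = L x - L y"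
    have s: "0 < s" using xy by (simp add: s_def)
    \<comment> \<open>The point of the segment from \<open>x\<close> to \<open>y\<close> at which
      \<open>L\<close> vanishes.\<close>
    define z where "z = (- L y / s) *\<^sub>R x + (L x / s) *\<^sub>R y"
    have "z \<in> X" unfolding z_def
      by (rule convexD[OF X(1)]) (use xy s in \<open>auto simp: s_def divide_simps\<close>)
    moreover have "L z = 0"
      using s by (simp add: z_def linear_diff[OF assms(3)] linear_scale[OF assms(3)])
    ultimately have "\<Phi> z \<le> c" by (rule le)
    then have "- L y * \<Phi> x + L x * \<Phi> y \<le> c * s"
      using s by (simp add: z_def linear_diff[OF assms(4)] linear_scale[OF assms(4)] field_simps)
    then show ?thesis using xy by (simp add: s_def field_simps)
  qed
  define A where "A = {(\<Phi> x - c) / L x | x. x \<in> X \<and> 0 < L x}"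
  obtain x0 where x0: "x0 \<in> X" "0 < L x0" using True by blast
  then have "A \<noteq> {}" by (auto simp: A_def)
  have y0: "- x0 \<in> X" "L (- x0) < 0" using x0 X(2) linear_neg[OF assms(3)] by auto
  have bdd: "bdd_above A"
    unfolding A_def using cross[OF _ y0(1) _ y0(2)] by (intro bdd_aboveI) blast
  show thesis
  proof (rule that[of "- Sup A"])
    fix x assume x: "x \<in> X"
    consider "0 < L x" | "L x = 0" | "L x < 0" by linarith
    then show "\<Phi> x + - Sup A * L x \<le> c"
    proof cases
      case 1
      then have "(\<Phi> x - c) / L x \<le> Sup A" using x bdd by (intro cSup_upper) (auto simp: A_def)
      then show ?thesis using 1 by (simp add: field_simps)
    next
      case 2
      then show ?thesis using le x by simp
    next
      case 3
      then have "Sup A \<le> (\<Phi> x - c) / L x"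
        using cross[OF _ x _ 3] by (intro cSup_least \<open>A \<noteq> {}\<close>) (auto simp: A_def)
      then show ?thesis using 3 by (simp add: field_simps)
    qed
  qed
qed

text \<open>Remove the constraint \<open>j\<close> inside the set \<open>Z\<close> cut out by the
  others, which is again convex and symmetric. The remaining constraints are then removed for the
  objective \<open>\<Phi> + k * L j\<close>.\<close>

lemma lagrange_multipliers:
  fixes X :: "'v::real_vector set" and L :: "'i \<Rightarrow> 'v \<Rightarrow> real"
  assumes "finite I" "convex X" "\<And>x. x \<in> X \<Longrightarrow> - x \<in> X"
    and "\<And>i. i \<in> I \<Longrightarrow> linear (L i)" "linear \<Phi>"
    and "\<And>x. x \<in> X \<Longrightarrow> (\<And>i. i \<in> I \<Longrightarrow> L i x = 0) \<Longrightarrow> \<Phi> x \<le> c"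
  shows "\<exists>m. \<forall>x\<in>X. \<Phi> x + (\<Sum>i\<in>I. m i * L i x) \<le> c"
  using assms(1,4-6)
proof (induction I arbitrary: \<Phi> rule: finite_induct)
  case empty
  then show ?case by auto
next
  case (insert j I)
  define Z where "Z = X \<inter> {x. \<forall>i\<in>I. L i x = 0}"
  have lin: "linear (L i)" if "i \<in> insert j I" for i using insert.prems(1) that by blast
  have "convex Z"
    using assms(2) lin unfolding Z_def convex_def
    by (auto simp: linear_add linear_scale)
  moreover have "- x \<in> Z" if "x \<in> Z" for x
    using that assms(3) lin by (auto simp: Z_def linear_neg)
  moreover have "\<Phi> x \<le> c" if "x \<in> Z" "L j x = 0" for x
    using that insert.prems(3) by (auto simp: Z_def)
  ultimately obtain k where k: "\<And>x. x \<in> Z \<Longrightarrow> \<Phi> x + k * L j x \<le> c"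
    using lagrange_multiplier[of Z "L j" \<Phi> c] lin insert.prems(2) by blast
  have "linear (\<lambda>x. \<Phi> x + k * L j x)"
    using insert.prems(2) lin[of j]
    by (intro linear_compose_add) (auto simp: linear_iff algebra_simps)
  then obtain m where m: "\<forall>x\<in>X. \<Phi> x + k * L j x + (\<Sum>i\<in>I. m i * L i x) \<le> c"
    using insert.IH[of "\<lambda>x. \<Phi> x + k * L j x"] lin k by (auto simp: Z_def)
  have "(\<Sum>i\<in>I. (m(j := k)) i * L i x) = (\<Sum>i\<in>I. m i * L i x)" for x
    using insert.hyps by (intro sum.cong) auto
  with m insert.hyps show ?case
    by (intro exI[of _ "m(j := k)"]) (auto simp: add.assoc)
qed

section \<open>Norm-additive splittings and extreme points\<close>

lemma norm_blinfun_le_real: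
  fixes a :: "'b::real_normed_vector \<Rightarrow>\<^sub>L real"
  assumes "\<And>f. norm f \<le> 1 \<Longrightarrow> blinfun_apply a f \<le> c"
  shows "norm a \<le> c"
proof (rule norm_blinfun_bound)
  show c: "0 \<le> c" using assms[of 0] by simp
  fix f
  show "norm (blinfun_apply a f) \<le> c * norm f"
  proof (cases "f = 0")
    case False
    have "blinfun_apply a (f /\<^sub>R norm f) \<le> c" "blinfun_apply a (- (f /\<^sub>R norm f)) \<le> c"
      using False by (auto intro!: assms)
    then have "\<bar>blinfun_apply a f\<bar> / norm f \<le> c"
      using False by (simp add: blinfun.scaleR_right blinfun.minus_right abs_if field_simps)
    then show ?thesis using False by (simp add: field_simps)
  qed simp
qed

text \<open>Since \<open>f\<close> and \<open>g\<close> vary independently, the supremum can be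
  taken over \<open>f\<close> for fixed \<open>g\<close> and then over \<open>g\<close>.\<close>

lemma norm_blinfun_add_le:
  fixes a :: "'b::real_normed_vector \<Rightarrow>\<^sub>L real" and b :: "'c::real_normed_vector \<Rightarrow>\<^sub>L real"
  assumes "\<And>f g. norm f \<le> 1 \<Longrightarrow> norm g \<le> 1 \<Longrightarrow> blinfun_apply a f + blinfun_apply b g \<le> c"
  shows "norm a + norm b \<le> c"
proof -
  have "norm a \<le> c - blinfun_apply b g" if "norm g \<le> 1" for g
    using assms[OF _ that] by (intro norm_blinfun_le_real) (simp add: algebra_simps)
  then have "norm b \<le> c - norm a"
    by (intro norm_blinfun_le_real) (simp add: algebra_simps)
  then show ?thesis by simp
qed

lemma lf_positive_mono:
  assumes "lf_positive \<phi>" "\<And>x. apply_lip0 f x \<le> apply_lip0 g x"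
  shows "blinfun_apply \<phi> f \<le> blinfun_apply \<phi> g"
proof -
  have "0 \<le> blinfun_apply \<phi> (g - f)"
    using assms unfolding lf_positive_def by (simp add: apply_lip0_simps)
  then show ?thesis by (simp add: blinfun.diff_right)
qed

text \<open>The multipliers are applied to pairs \<open>(f, g)\<close> in a product of two unit
  balls, with one constraint \<open>f x = g x\<close> for each point of \<open>F\<close>. A term
  \<open>m x * (g x - f x)\<close> shifts an evaluation from one functional to the other, so their
  sum stays \<open>lam + \<mu>\<close>.\<close>

lemma norm_additive_splitting:
  fixes lam \<mu> :: "'a::pointed_metric_space lip0 \<Rightarrow>\<^sub>L real"
  assumes pos: "lf_positive lam" and "finite F"
    and F: "\<And>f. (\<And>x. x \<in> F \<Longrightarrow> apply_lip0 f x = 0) \<Longrightarrow> blinfun_apply \<mu> f = 0"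
    and norm: "norm (lam + \<mu>) \<le> 1"
    and h: "lip_multiplier B h" "\<And>x. 0 \<le> h x" "\<And>x. h x \<le> 1"
  obtains m where "norm (lf_weight h lam - (\<Sum>x\<in>F. m x *\<^sub>R lf_delta x)) +
    norm (lam + \<mu> - (lf_weight h lam - (\<Sum>x\<in>F. m x *\<^sub>R lf_delta x))) \<le> 1"
proof -
  define X :: "('a lip0 \<times> 'a lip0) set" where "X = cball 0 1 \<times> cball 0 1"
  define L where "L = (\<lambda>x. \<lambda>p::'a lip0 \<times> 'a lip0. apply_lip0 (snd p) x - apply_lip0 (fst p) x)"
  define \<Phi> where "\<Phi> = (\<lambda>p. blinfun_apply (lf_weight h lam) (fst p) +
    blinfun_apply (lam + \<mu> - lf_weight h lam) (snd p))"
  have "\<exists>m. \<forall>p\<in>X. \<Phi> p + (\<Sum>x\<in>F. m x * L x p) \<le> 1"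
  proof (rule lagrange_multipliers)
    show "convex X" unfolding X_def by (intro convex_Times convex_cball)
    show "- p \<in> X" if "p \<in> X" for p using that by (auto simp: X_def)
    show "linear (L x)" for x
      by (auto simp: L_def linear_iff apply_lip0_simps algebra_simps)
    show "linear \<Phi>"
      by (auto simp: \<Phi>_def linear_iff blinfun.add_right blinfun.scaleR_right algebra_simps)
    fix p assume p: "p \<in> X" and "\<And>x. x \<in> F \<Longrightarrow> L x p = 0"
    obtain f g where fg: "p = (f, g)" by force
    have n: "norm f \<le> 1" "norm g \<le> 1" using p by (auto simp: fg X_def)
    have eq: "apply_lip0 f x = apply_lip0 g x" if "x \<in> F" for x
      using \<open>\<And>x. x \<in> F \<Longrightarrow> L x p = 0\<close>[OF that] by (simp add: L_def fg)
    \<comment> \<open>Unlike the mixture \<open>h * f + (1 - h) * g\<close>, which it dominates, the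
      maximum keeps the Lipschitz constant 1. It agrees with \<open>g\<close> on \<open>F\<close>,
      so \<mu> takes the same value at both.\<close>
    define k where "k = Lip0 (\<lambda>x. max (apply_lip0 f x) (apply_lip0 g x))"
    have "\<bar>max (apply_lip0 f x) (apply_lip0 g x) - max (apply_lip0 f y) (apply_lip0 g y)\<bar>
        \<le> 1 * dist x y" for x y
    proof -
      have "\<bar>apply_lip0 f x - apply_lip0 f y\<bar> \<le> dist x y" "\<bar>apply_lip0 g x - apply_lip0 g y\<bar> \<le> dist x y"
        using abs_apply_lip0_diff_le[of f x y] abs_apply_lip0_diff_le[of g x y] n
          mult_right_mono[of "norm f" 1 "dist x y"] mult_right_mono[of "norm g" 1 "dist x y"]
        by auto
      then show ?thesis by linarith
    qed
    then have k: "apply_lip0 k = (\<lambda>x. max (apply_lip0 f x) (apply_lip0 g x))" "norm k \<le> 1"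
      unfolding k_def by (auto intro!: apply_Lip0[of 1] norm_Lip0_le)
    have "blinfun_apply \<mu> (g - k) = 0"
      by (rule F) (simp add: eq k apply_lip0_simps)
    then have "\<Phi> p = blinfun_apply lam (lip0_mult h f + (g - lip0_mult h g)) + blinfun_apply \<mu> k"
      by (simp add: \<Phi>_def fg lf_weight_apply[OF h(1)] blinfun.add_left blinfun.diff_left
          blinfun.add_right blinfun.diff_right)
    also have "\<dots> \<le> blinfun_apply lam k + blinfun_apply \<mu> k"
    proof (intro add_right_mono lf_positive_mono[OF pos])
      fix x
      have "h x * apply_lip0 f x + (1 - h x) * apply_lip0 g x \<le>
          h x * apply_lip0 k x + (1 - h x) * apply_lip0 k x"
        using h(2,3)[of x] by (intro add_mono mult_left_mono) (auto simp: k)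
      then show "apply_lip0 (lip0_mult h f + (g - lip0_mult h g)) x \<le> apply_lip0 k x"
        by (simp add: apply_lip0_simps apply_lip0_mult[OF h(1)] algebra_simps)
    qed
    also have "\<dots> \<le> norm (lam + \<mu>) * norm k"
      using norm_blinfun[of "lam + \<mu>" k] by (simp add: blinfun.add_left)
    also have "\<dots> \<le> 1 * 1" using norm k(2) by (intro mult_mono) auto
    finally show "\<Phi> p \<le> 1" by simp
  qed fact
  then obtain m where m: "\<And>p. p \<in> X \<Longrightarrow> \<Phi> p + (\<Sum>x\<in>F. m x * L x p) \<le> 1" by blast
  show thesis
  proof (rule that[of m], rule norm_blinfun_add_le)
    fix f g :: "'a lip0" assume "norm f \<le> 1" "norm g \<le> 1"
    then have "(f, g) \<in> X" by (simp add: X_def)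
    from m[OF this] show
      "blinfun_apply (lf_weight h lam - (\<Sum>x\<in>F. m x *\<^sub>R lf_delta x)) f +
        blinfun_apply (lam + \<mu> - (lf_weight h lam - (\<Sum>x\<in>F. m x *\<^sub>R lf_delta x))) g \<le> 1"
      by (simp add: \<Phi>_def L_def blinfun.add_left blinfun.diff_left blinfun.sum_left
          blinfun.scaleR_left right_diff_distrib sum_subtractf)
  qed
qed

text \<open>Rescaled to the common norm \<open>s \<le> 1\<close>, the summands \<alpha> and
  \<open>\<phi> - \<alpha>\<close> lie in the ball and have \<phi> as a convex combination.
  Extremality makes them coincide. The case \<open>\<phi> = \<alpha>\<close> is separate because 0
  cannot be rescaled.\<close>

lemma extreme_point_splitting:
  assumes ext: "\<phi> extreme_point_of lipfree_ball"
    and "\<alpha> \<in> lipfree" "\<alpha> \<noteq> 0" and le: "norm \<alpha> + norm (\<phi> - \<alpha>) \<le> 1"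
  obtains c where "c \<noteq> 0" "\<phi> = c *\<^sub>R \<alpha>"
proof (cases "\<phi> = \<alpha>")
  case True
  then show thesis using that[of 1] by simp
next
  case False
  define \<beta> where "\<beta> = \<phi> - \<alpha>"
  define a b s where "a = norm \<alpha>" "b = norm \<beta>" "s = a + b"
  have pos: "0 < a" "0 < b" "0 < s" "s \<le> 1"
    using assms(3) False le by (auto simp: \<beta>_def a_b_s_def add_pos_pos)
  have "\<phi> \<in> lipfree" using ext by (auto simp: extreme_point_of_def lipfree_ball_def)
  then have "\<beta> \<in> lipfree"
    unfolding \<beta>_def using assms(2) subspace_diff[OF subspace_lipfree_on] by blast
  then have y: "(s / a) *\<^sub>R \<alpha> \<in> lipfree_ball" and z: "(s / b) *\<^sub>R \<beta> \<in> lipfree_ball"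
    using assms(2) pos subspace_scale[OF subspace_lipfree_on]
    by (auto simp: lipfree_ball_def simp flip: a_b_s_def(1,2))
  have "1 - b / s = a / s" using pos by (simp add: a_b_s_def(3) field_simps)
  then have "\<phi> = (1 - b / s) *\<^sub>R (s / a) *\<^sub>R \<alpha> + (b / s) *\<^sub>R (s / b) *\<^sub>R \<beta>"
    using pos by (simp add: \<beta>_def)
  moreover have "0 < b / s" "b / s < 1" using pos by (auto simp: a_b_s_def(3))
  ultimately have "\<phi> \<in> open_segment ((s / a) *\<^sub>R \<alpha>) ((s / b) *\<^sub>R \<beta>)"
    if "(s / a) *\<^sub>R \<alpha> \<noteq> (s / b) *\<^sub>R \<beta>"
    unfolding in_segment using that by blast
  with ext y z have "(s / a) *\<^sub>R \<alpha> = (s / b) *\<^sub>R \<beta>"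
    unfolding extreme_point_of_def by blast
  with \<open>\<phi> = _\<close> have "\<phi> = (1 - b / s + b / s) *\<^sub>R (s / a) *\<^sub>R \<alpha>"
    by (metis scaleR_left_distrib)
  then show thesis using that[of "s / a"] pos by simp
qed

text \<open>Functions vanishing on \<open>F\<close> do not see the evaluations subtracted in
  \<alpha>, so proportionality to \<alpha> becomes proportionality to the weighted functional. The
  function \<open>f\<close> witnesses \<open>\<alpha> \<noteq> 0\<close>.\<close>

lemma extreme_point_eq_weight:
  fixes lam \<mu> :: "'a::pointed_metric_space lip0 \<Rightarrow>\<^sub>L real"
  assumes "lam \<in> lipfree" "lf_positive lam" "finite F"
    and F: "\<And>f. (\<And>x. x \<in> F \<Longrightarrow> apply_lip0 f x = 0) \<Longrightarrow> blinfun_apply \<mu> f = 0"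
    and ext: "(lam + \<mu>) extreme_point_of lipfree_ball"
    and h: "lip_multiplier B h" "\<And>x. 0 \<le> h x" "\<And>x. h x \<le> 1"
    and f: "blinfun_apply (lf_weight h lam) f \<noteq> 0" "\<And>x. x \<in> F \<Longrightarrow> apply_lip0 f x = 0"
  obtains c where "c \<noteq> 0" "\<And>g. (\<And>x. x \<in> F \<Longrightarrow> apply_lip0 g x = 0) \<Longrightarrow>
    blinfun_apply (lam + \<mu>) g = c * blinfun_apply (lf_weight h lam) g"
proof -
  have "norm (lam + \<mu>) \<le> 1"
    using ext by (simp add: extreme_point_of_def lipfree_ball_def)
  then obtain m where m: "norm (lf_weight h lam - (\<Sum>x\<in>F. m x *\<^sub>R lf_delta x)) +
      norm (lam + \<mu> - (lf_weight h lam - (\<Sum>x\<in>F. m x *\<^sub>R lf_delta x))) \<le> 1"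
    using norm_additive_splitting[OF assms(2,3) F _ h] by blast
  define \<alpha> where "\<alpha> = lf_weight h lam - (\<Sum>x\<in>F. m x *\<^sub>R lf_delta x)"
  have \<alpha>: "blinfun_apply \<alpha> g = blinfun_apply (lf_weight h lam) g"
    if "\<And>x. x \<in> F \<Longrightarrow> apply_lip0 g x = 0" for g
    using that by (simp add: \<alpha>_def blinfun.diff_left blinfun.sum_left blinfun.scaleR_left)
  have "\<alpha> \<in> lipfree"
    unfolding \<alpha>_def
    by (intro subspace_diff[OF subspace_lipfree_on] subspace_sum[OF subspace_lipfree_on]
        subspace_scale[OF subspace_lipfree_on] lf_delta_in_lipfree_on
        lf_weight_in_lipfree_on[OF h(1) assms(1)]) auto
  moreover have "\<alpha> \<noteq> 0" using \<alpha>[OF f(2)] f(1) by auto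
  ultimately obtain c where "c \<noteq> 0" "lam + \<mu> = c *\<^sub>R \<alpha>"
    using extreme_point_splitting[OF ext _ _ m[folded \<alpha>_def]] by blast
  then show thesis using that[of c] \<alpha> by (simp add: blinfun.scaleR_left)
qed

section \<open>Finiteness of the support\<close>

theorem theorem3p10:
  fixes lam \<mu> :: "'a::{pointed_metric_space, complete_space} lip0 \<Rightarrow>\<^sub>L real"
  assumes "lam \<in> lipfree" and "\<mu> \<in> lipfree"
    and "lf_positive lam"
    and "finite (lf_supp \<mu>)"
    and "(lam + \<mu>) extreme_point_of lipfree_ball"
  shows "finite (lf_supp (lam + \<mu>))"
proof -
  define F where "F = lf_supp \<mu>"
  have F: "blinfun_apply \<mu> f = 0" if "\<And>x. x \<in> F \<Longrightarrow> apply_lip0 f x = 0" for f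
    using vanishes_on_lf_supp[OF assms(2)] that by (simp add: F_def)
  have "finite F" using assms(4) by (simp add: F_def)
  \<comment> \<open>The points at which \<open>lam\<close> is locally nonzero.\<close>
  define D where "D = {x. \<forall>r>0. lf_weight (bump x r) lam \<noteq> 0}"
  have supp: "lf_supp (lam + \<mu>) \<subseteq> F \<union> D"
  proof (rule subsetI, rule ccontr)
    fix x assume x: "x \<in> lf_supp (lam + \<mu>)" "x \<notin> F \<union> D"
    then obtain r where r: "0 < r" "lf_weight (bump x r) lam = 0" by (auto simp: D_def)
    obtain t where t: "0 < t" "\<mu> \<in> lipfree_on (- ball x t)"
      using x(2) not_in_lf_supp[of x \<mu>] by (auto simp: F_def)
    define q where "q = min r t"
    have q: "0 < q" "q \<le> r" "q \<le> t" using r t by (auto simp: q_def)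
    \<comment> \<open>As \<open>bump x r\<close> annihilates \<open>lam\<close>, weighting by
      \<open>1 - bump x r\<close> leaves \<open>lam\<close> unchanged; this weight is 0 on
      \<open>ball x r\<close>.\<close>
    obtain B where B: "lip_multiplier B (\<lambda>y. 1 - bump x r y)"
    proof
      show "lip_multiplier (4 + dist x base_point / r) (\<lambda>y. 1 - bump x r y)"
        unfolding lip_multiplier_def
      proof (intro conjI allI)
        show "\<bar>1 - bump x r y\<bar> \<le> 4 + dist x base_point / r" for y
          using bump_bounds[of x r y] r(1) by (simp add: add_increasing2)
        fix y z
        have "\<bar>bump x r y - bump x r z\<bar> * dist y base_point \<le> (3 + dist x base_point / r) * dist y z"
          using lip_multiplier_bump[OF r(1), of x] unfolding lip_multiplier_def by blast
        also have "\<dots> \<le> (4 + dist x base_point / r) * dist y z" by (intro mult_right_mono) auto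
        finally show "\<bar>1 - bump x r y - (1 - bump x r z)\<bar> * dist y base_point
            \<le> (4 + dist x base_point / r) * dist y z"
          by (simp add: abs_minus_commute)
      qed
    qed
    have "lf_weight (\<lambda>y. 1 - bump x r y) lam = lam"
    proof (rule blinfun_eqI)
      fix f
      have "lip0_mult (\<lambda>y. 1 - bump x r y) f = f - lip0_mult (bump x r) f"
        by (rule lip0_eqI)
          (simp add: apply_lip0_mult[OF B] apply_lip0_mult_bump[OF r(1)] apply_lip0_simps algebra_simps)
      moreover have "blinfun_apply lam (lip0_mult (bump x r) f) = 0"
        using r(2) lf_weight_bump_apply[OF r(1), of x lam f] by simp
      ultimately show "blinfun_apply (lf_weight (\<lambda>y. 1 - bump x r y) lam) f = blinfun_apply lam f"
        by (simp add: lf_weight_apply[OF B] blinfun.diff_right)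
    qed
    moreover have "lf_weight (\<lambda>y. 1 - bump x r y) lam \<in> lipfree_on (- ball x r)"
      by (rule lf_weight_in_lipfree_on[OF B assms(1)]) (auto simp: bump_eq_1[OF r(1) less_imp_le])
    ultimately have "lam \<in> lipfree_on (- ball x q)"
      using lipfree_on_mono[of "- ball x r" "- ball x q"] subset_ball[of q r x] q by auto
    moreover have "\<mu> \<in> lipfree_on (- ball x q)"
      using t(2) lipfree_on_mono[of "- ball x t" "- ball x q"] subset_ball[of q t x] q by auto
    ultimately have "lam + \<mu> \<in> lipfree_on (- ball x q)"
      by (rule subspace_add[OF subspace_lipfree_on])
    moreover have "closed (- ball x q)" "x \<notin> - ball x q" using q by auto
    ultimately show False using x(1) unfolding lf_supp_def by blast
  qed
  have "p = q" if pq: "p \<in> D - F" "q \<in> D - F" for p q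
  proof (rule ccontr)
    assume "p \<noteq> q"
    obtain d where d: "0 < d" "\<And>x. x \<in> insert q F \<Longrightarrow> x \<noteq> p \<Longrightarrow> d \<le> dist p x"
      using finite_set_avoid[of "insert q F" p] \<open>finite F\<close> by auto
    obtain e where e: "0 < e" "\<And>x. x \<in> F \<Longrightarrow> x \<noteq> q \<Longrightarrow> e \<le> dist q x"
      using finite_set_avoid[OF \<open>finite F\<close>, of q] by auto
    \<comment> \<open>Bumps of radius \<open>2 * r\<close> reach out to \<open>4 * r\<close> and
      must avoid \<open>F\<close>; such a bump at \<open>p\<close> must also miss the bump of radius
      \<open>r\<close> at \<open>q\<close>, which takes
      \<open>4 * r + 2 * r = 6 * r\<close>.\<close>
    define r where "r = min d e / 6"
    have r: "0 < r" "6 * r \<le> d" "6 * r \<le> e" using d(1) e(1) by (auto simp: r_def)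
    have r2: "0 < 2 * r" using r by simp
    note h = lip_multiplier_bump[OF r(1)] bump_bounds
    \<comment> \<open>The wide bump is 1 where the narrow one is nonzero. Test functions can thus be
      made to vanish on \<open>F\<close> without changing the value of the weighted
      functional.\<close>
    have wide: "lip0_mult (bump x r) (lip0_mult (bump x (2 * r)) f) = lip0_mult (bump x r) f"
      for x :: 'a and f
    proof (rule lip0_eqI)
      fix y
      show "apply_lip0 (lip0_mult (bump x r) (lip0_mult (bump x (2 * r)) f)) y =
          apply_lip0 (lip0_mult (bump x r) f) y"
        using bump_eq_0[OF r(1), of x y] bump_eq_1[OF r2, of x y]
        by (cases "dist x y \<le> 2 * r") (auto simp: apply_lip0_mult_bump r(1))
    qed
    have ex: "\<exists>g. blinfun_apply (lf_weight (bump x r) lam) (lip0_mult (bump x (2 * r)) g) \<noteq> 0"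
      if x: "x \<in> D" for x
    proof -
      have "lf_weight (bump x r) lam \<noteq> 0" using x r(1) by (auto simp: D_def)
      then obtain g where "blinfun_apply (lf_weight (bump x r) lam) g \<noteq> 0"
        by (metis blinfun_eqI blinfun.zero_left)
      then show ?thesis by (auto simp: lf_weight_bump_apply[OF r(1)] wide)
    qed
    have off: "apply_lip0 (lip0_mult (bump x (2 * r)) g) y = 0" if "4 * r \<le> dist x y" for x y :: 'a and g
      using bump_eq_0[OF r2, of x y] that by (simp add: apply_lip0_mult_bump[OF r2])
    have far: "4 * r \<le> dist p y" "4 * r \<le> dist q y" if "y \<in> F" for y
      using d(2)[of y] e(2)[of y] r that pq by force+
    obtain f where f: "blinfun_apply (lf_weight (bump p r) lam) (lip0_mult (bump p (2 * r)) f) \<noteq> 0"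
      using ex pq by blast
    obtain g where g: "blinfun_apply (lf_weight (bump q r) lam) (lip0_mult (bump q (2 * r)) g) \<noteq> 0"
      using ex pq by blast
    obtain a where a: "a \<noteq> 0" "\<And>u. (\<And>x. x \<in> F \<Longrightarrow> apply_lip0 u x = 0) \<Longrightarrow>
        blinfun_apply (lam + \<mu>) u = a * blinfun_apply (lf_weight (bump p r) lam) u"
      using extreme_point_eq_weight[OF assms(1,3) \<open>finite F\<close> F assms(5) h f] off far(1) by metis
    obtain b where b: "b \<noteq> 0" "\<And>u. (\<And>x. x \<in> F \<Longrightarrow> apply_lip0 u x = 0) \<Longrightarrow>
        blinfun_apply (lam + \<mu>) u = b * blinfun_apply (lf_weight (bump q r) lam) u"
      using extreme_point_eq_weight[OF assms(1,3) \<open>finite F\<close> F assms(5) h g] off far(2) by metis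
    \<comment> \<open>This function lives near \<open>p\<close>: the proportionality at
      \<open>p\<close> makes \<open>lam + \<mu>\<close> nonzero there, while the one at
      \<open>q\<close> makes it 0.\<close>
    let ?u = "lip0_mult (bump p (2 * r)) f"
    have "blinfun_apply (lam + \<mu>) ?u \<noteq> 0" using a f off far(1) by simp
    moreover have "blinfun_apply (lam + \<mu>) ?u = b * blinfun_apply (lf_weight (bump q r) lam) ?u"
      using b(2) off far(1) by simp
    moreover have "lip0_mult (bump q r) ?u = 0"
    proof (rule lip0_eqI)
      fix y
      have "4 * r \<le> dist p y \<or> 2 * r \<le> dist q y"
        using d(2)[of q] \<open>p \<noteq> q\<close> r dist_triangle[of p q y] by (auto simp: dist_commute)
      then show "apply_lip0 (lip0_mult (bump q r) ?u) y = apply_lip0 0 y"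
        using off[of p y] bump_eq_0[OF r(1), of q y]
        by (auto simp: apply_lip0_mult_bump[OF r(1)] apply_lip0_simps)
    qed
    ultimately show False by (simp add: lf_weight_bump_apply[OF r(1)])
  qed
  then have "finite (D - F)"
    by (metis finite.emptyI finite.insertI finite_subset insertI1 subsetI all_not_in_conv)
  then show ?thesis
    using supp \<open>finite F\<close> finite_subset[of _ "F \<union> (D - F)"] by auto
qed

end
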